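(* Let $p:(0,1)\to[1,\infty)$ be a nondecreasing function such that $p(1)<\infty$. Then the following statements are equivalent: 1. There exists a constant $C>0$ such that for every positive measurable function $f$ on $(0,1)$, $$\left\| \frac1x\int_0^x f(t)\,dt\right\|_{L^{p(\cdot)}(0,1)}\le C\,\|f\|_{L^{p(\cdot)}(0,1)}.$$ 2. There exists a constant $C>0$ such that $$\int_a^1 x^{-\frac1{p'(x)}}\frac{dx}{x}\le C a^{-\frac1{p'(a)}}\quad\text{for all }0<a<1.$$ 3. There exist $\epsilon>0$ and $C>0$ such that $$t_2^{-\frac1{p'(t_2)}+\epsilon}\le C\,t_1^{-\frac1{p'(t_1)}+\epsilon}\quad\text{for all }0<t_1\le t_2<1.$$ 4. There exists a constant $C>0$ such that $$\int_a^1\left(a^{\frac1{p'(a)}}x^{-\frac1{p'(x)}}\right)^{p(x)}\frac{dx}{x}\le C\quad\text{for all }0<a<1.$$ 5. There exists a constant $C>0$ such that $$\left\|x^{-1}\right\|_{L^{p(\cdot)}(a,1)}\le C a^{-\frac1{p'(a)}}\quad\text{for all }0<a<1.$$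
   Context: $p(1)$ denotes $\lim_{x\to1^-}p(x)=\sup_{(0,1)}p$. The conjugate exponent $p'$ is defined by $\frac1{p(x)}+\frac1{p'(x)}=1$, with $p'(x)=\infty$ (so $\frac1{p'(x)}=0$) if $p(x)=1$. For an interval $J\subset(0,1)$ and measurable $f$ on $J$, $\|f\|_{L^{p(\cdot)}(J)}=\inf\{\lambda>0:\int_J|f(x)/\lambda|^{p(x)}dx\le1\}$ (equal to $+\infty$ if there is no such $\lambda$). In item 5 the norm is that of the function $x\mapsto x^{-1}$ on $(a,1)$. "Positive" means $f\ge0$. The constants may differ from one item to another, and depend on neither $f$, $a$, $t_1$ nor $t_2$. *)

theory Defs
  imports "HOL-Analysis.Analysis"
begin

definition conj_exponent :: "real \<Rightarrow> ereal" where
  "conj_exponent q = (if q = 1 then \<infinity> else ereal (q / (q - 1)))"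

text \<open>
  The exponent \<open>p'\<close> itself may be infinite, but \<open>1/p'(x)\<close>, the only way in which it is used,
  is always a real number (with \<open>1/\<infinity> = 0\<close>).
\<close>

definition recip_conj :: "(real \<Rightarrow> real) \<Rightarrow> real \<Rightarrow> real" where
  "recip_conj p x = real_of_ereal (1 / conj_exponent (p x))"

lemma conj_exponent_sum:
  assumes "1 \<le> q"
  shows "1 / ereal q + 1 / conj_exponent q = 1"
  using assms by (auto simp: conj_exponent_def one_ereal_def field_simps)

lemma recip_conj_eq:
  assumes "1 \<le> p x"
  shows "recip_conj p x = 1 - 1 / p x"
  using assms by (auto simp: recip_conj_def conj_exponent_def one_ereal_def field_simps)

text \<open>
  Real powers on \<open>[0, \<infinity>]\<close> for exponents \<open>r > 0\<close>, so that \<open>\<infinity>\<close> to the power \<open>r\<close> is \<open>\<infinity>\<close>.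
\<close>

definition ennpowr :: "ennreal \<Rightarrow> real \<Rightarrow> ennreal" where
  "ennpowr u r = (if u = \<infinity> then \<infinity> else ennreal (enn2real u powr r))"

text \<open>
  The Luxemburg norm depends on a function only through its modulus, so it is defined on
  functions with values in \<open>[0, \<infinity>]\<close>; the value \<open>\<infinity>\<close> is needed because the averages of a
  nonnegative function that is not integrable near \<open>0\<close> are infinite.
  The infimum of the empty set is \<open>\<infinity>\<close>.
\<close>

definition luxemburg_norm :: "(real \<Rightarrow> real) \<Rightarrow> real set \<Rightarrow> (real \<Rightarrow> ennreal) \<Rightarrow> ennreal" where
  "luxemburg_norm p J f =
     Inf {ennreal l | l. 0 < l \<and>
       (\<integral>\<^sup>+ x. ennpowr (f x / ennreal l) (p x) \<partial>(lebesgue_on J)) \<le> 1}"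

definition hardy_average :: "(real \<Rightarrow> real) \<Rightarrow> real \<Rightarrow> ennreal" where
  "hardy_average f x = (\<integral>\<^sup>+ t. ennreal (f t) \<partial>(lebesgue_on {0<..<x})) / ennreal x"

definition hardy_inequality :: "(real \<Rightarrow> real) \<Rightarrow> bool" where
  "hardy_inequality p \<longleftrightarrow>
     (\<exists>C>0. \<forall>f :: real \<Rightarrow> real.
        f \<in> borel_measurable (lebesgue_on {0<..<1}) \<longrightarrow> (\<forall>x\<in>{0<..<1}. 0 \<le> f x) \<longrightarrow>
        luxemburg_norm p {0<..<1} (hardy_average f)
          \<le> ennreal C * luxemburg_norm p {0<..<1} (\<lambda>x. ennreal (f x)))"

definition tail_integral_condition :: "(real \<Rightarrow> real) \<Rightarrow> bool" where
  "tail_integral_condition p \<longleftrightarrow>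
     (\<exists>C>0. \<forall>a\<in>{0<..<1}.
        (\<integral>\<^sup>+ x. ennreal (x powr (- recip_conj p x) / x) \<partial>(lebesgue_on {a<..<1}))
          \<le> ennreal (C * a powr (- recip_conj p a)))"

definition almost_decreasing_condition :: "(real \<Rightarrow> real) \<Rightarrow> bool" where
  "almost_decreasing_condition p \<longleftrightarrow>
     (\<exists>\<epsilon>>0. \<exists>C>0. \<forall>t1 t2. 0 < t1 \<longrightarrow> t1 \<le> t2 \<longrightarrow> t2 < 1 \<longrightarrow>
        t2 powr (- recip_conj p t2 + \<epsilon>) \<le> C * t1 powr (- recip_conj p t1 + \<epsilon>))"

definition tail_modular_condition :: "(real \<Rightarrow> real) \<Rightarrow> bool" where
  "tail_modular_condition p \<longleftrightarrow>
     (\<exists>C>0. \<forall>a\<in>{0<..<1}.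
        (\<integral>\<^sup>+ x. ennreal ((a powr recip_conj p a * x powr (- recip_conj p x)) powr p x / x)
            \<partial>(lebesgue_on {a<..<1}))
          \<le> ennreal C)"

definition tail_norm_condition :: "(real \<Rightarrow> real) \<Rightarrow> bool" where
  "tail_norm_condition p \<longleftrightarrow>
     (\<exists>C>0. \<forall>a\<in>{0<..<1}.
        luxemburg_norm p {a<..<1} (\<lambda>x. ennreal (inverse x))
          \<le> ennreal (C * a powr (- recip_conj p a)))"

end

theory Submission
  imports Defs
begin

text \<open>
  Write \<open>\<phi>(x) = x\<^bsup>-1/p'(x)\<^esup>\<close>. Then \<open>\<phi> \<ge> 1\<close>, and \<open>x \<phi>(x) = x\<^bsup>1/p(x)\<^esup>\<close> is nondecreasing
  because \<open>p\<close> is.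

  Either of the integral conditions 2 and 4 yields a constant \<open>K\<close> such that \<open>\<phi>(b) \<le> \<phi>(a)/2\<close> for some
  \<open>b \<in> (a, Ka)\<close>, since otherwise the integral over \<open>(a, Ka)\<close> is at least a multiple of \<open>ln K\<close>. Iterating
  this, and using the monotonicity of \<open>x \<phi>(x)\<close> between the points so obtained, gives the power
  decay in condition 3. Condition 3 gives 2 and 4 by integrating \<open>(a/x)\<^bsup>\<epsilon>\<^esup>/x\<close>. Conditions 4 and 5 are the
  same because \<open>x\<^bsup>-p(x)\<^esup> = \<phi>(x)\<^bsup>p(x)\<^esup>/x\<close>, and testing the Hardy inequality on the indicator of \<open>(0, a)\<close>
  gives 5.

  For the Hardy inequality let \<open>f\<close> have modular at most 1. Condition 3 and a Young-type inequality, in which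
  \<open>p(t) \<le> p(x)\<close> for \<open>t \<le> x\<close> enters, bound \<open>f(t)\<close> by
  \<open>C/\<phi>(x) (t/x)\<^bsup>\<epsilon>\<^esup> (u/t + u\<^bsup>1-p(x)\<^esup> f(t)\<^bsup>p(t)\<^esup>)\<close> for every \<open>u \<in> (0, 1]\<close>. With \<open>m\<close> the integral of
  \<open>(t/x)\<^bsup>\<epsilon>\<^esup> f(t)\<^bsup>p(t)\<^esup>\<close> over \<open>(0, x)\<close>, the choice \<open>u = m\<^bsup>1/p(x)\<^esup>\<close> bounds the \<open>p(x)\<close>-th power of the
  average of \<open>f\<close>, up to a constant inside the power, by \<open>m/x\<close>, whose integral is controlled by
  Tonelli's theorem.
\<close>

section \<open>Integrals over subintervals, and explicit integrals of powers\<close>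

lemma nn_integral_lebesgue_on_subset:
  assumes "A \<in> sets lebesgue" "B \<in> sets lebesgue" "A \<subseteq> B"
  shows "(\<integral>\<^sup>+ x. f x \<partial>(lebesgue_on A)) = (\<integral>\<^sup>+ x. f x * indicator A x \<partial>(lebesgue_on B))"
proof -
  have "(\<integral>\<^sup>+ x. f x * indicator A x \<partial>(lebesgue_on B))
      = (\<integral>\<^sup>+ x. f x * indicator A x * indicator B x \<partial>lebesgue)"
    using assms by (subst nn_integral_restrict_space) auto
  also have "\<dots> = (\<integral>\<^sup>+ x. f x * indicator A x \<partial>lebesgue)"
    using assms by (intro nn_integral_cong) (auto split: split_indicator)
  finally show ?thesis
    using assms by (subst nn_integral_restrict_space) auto
qed

lemma nn_integral_lebesgue_on_mono_set:
  assumes "A \<in> sets lebesgue" "B \<in> sets lebesgue" "A \<subseteq> B"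
    and "\<And>x. x \<in> A \<Longrightarrow> f x \<le> g x"
  shows "(\<integral>\<^sup>+ x. f x \<partial>(lebesgue_on A)) \<le> (\<integral>\<^sup>+ x. g x \<partial>(lebesgue_on B))"
  unfolding nn_integral_lebesgue_on_subset[OF assms(1-3)]
  using assms(4) by (intro nn_integral_mono) (auto split: split_indicator)

lemma borel_measurable_imp_lebesgue_on:
  "f \<in> borel_measurable borel \<Longrightarrow> f \<in> borel_measurable (lebesgue_on A)"
  by (intro measurable_restrict_space1 measurable_completion) simp

text \<open>Continuity up to the endpoints is enough for the fundamental theorem, which matters for
  powers at \<open>0\<close>, where the antiderivative need not be differentiable. The sign of
  \<open>F'\<close> turns the gauge integral into a nonnegative Lebesgue integral.\<close>

lemma nn_integral_FTC_Ioo: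
  fixes F F' :: "real \<Rightarrow> real"
  assumes "a \<le> b" "continuous_on {a..b} F"
    and "\<And>x. x \<in> {a<..<b} \<Longrightarrow> (F has_real_derivative F' x) (at x)"
    and "\<And>x. x \<in> {a<..<b} \<Longrightarrow> 0 \<le> F' x"
  shows "(\<integral>\<^sup>+ x. ennreal (F' x) \<partial>(lebesgue_on {a<..<b})) = ennreal (F b - F a)"
proof -
  have "(F' has_integral (F b - F a)) {a..b}"
    using assms by (intro fundamental_theorem_of_calculus_interior)
      (auto simp: has_real_derivative_iff_has_vector_derivative)
  then have "(F' has_integral (F b - F a)) {a<..<b}"
    by (simp add: has_integral_Icc_iff_Ioo)
  then have "integral\<^sup>N lborel (\<lambda>x. ennreal (F' x) * indicator {a<..<b} x) = ennreal (F b - F a)"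
    using assms(4) by (intro nn_integral_has_integral_lebesgue') auto
  then show ?thesis
    by (subst nn_integral_restrict_space) (auto simp: nn_integral_completion)
qed

lemma nn_integral_inverse_Ioo:
  fixes a b :: real
  assumes "0 < a" "a \<le> b"
  shows "(\<integral>\<^sup>+ x. ennreal (1 / x) \<partial>(lebesgue_on {a<..<b})) = ennreal (ln (b / a))"
proof -
  have "(\<integral>\<^sup>+ x. ennreal (1 / x) \<partial>(lebesgue_on {a<..<b})) = ennreal (ln b - ln a)"
    using assms
    by (intro nn_integral_FTC_Ioo)
      (auto intro!: continuous_intros derivative_eq_intros)
  with assms show ?thesis
    by (simp add: ln_div)
qed

lemma nn_integral_powr_right_le:
  fixes a b \<epsilon> :: real
  assumes "0 < \<epsilon>" "0 < a" "a \<le> b"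
  shows "(\<integral>\<^sup>+ x. ennreal ((a / x) powr \<epsilon> / x) \<partial>(lebesgue_on {a<..<b})) \<le> ennreal (1 / \<epsilon>)"
proof -
  define F where "F = (\<lambda>x. - ((a / x) powr \<epsilon> / \<epsilon>))"
  have "(\<integral>\<^sup>+ x. ennreal ((a / x) powr \<epsilon> / x) \<partial>(lebesgue_on {a<..<b})) = ennreal (F b - F a)"
  proof (rule nn_integral_FTC_Ioo)
    show "(F has_real_derivative (a / x) powr \<epsilon> / x) (at x)" if "x \<in> {a<..<b}" for x
      unfolding F_def using that assms
      by (auto intro!: derivative_eq_intros simp: powr_diff field_simps power2_eq_square)
  qed (use assms in \<open>auto simp: F_def intro!: continuous_intros\<close>)
  also have "\<dots> \<le> ennreal (1 / \<epsilon>)"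
    using assms by (intro ennreal_leI) (simp add: F_def)
  finally show ?thesis .
qed

lemma nn_integral_powr_left:
  fixes x \<epsilon> :: real
  assumes "0 < \<epsilon>" "0 < x"
  shows "(\<integral>\<^sup>+ t. ennreal ((t / x) powr \<epsilon> / t) \<partial>(lebesgue_on {0<..<x})) = ennreal (1 / \<epsilon>)"
proof -
  define F where "F = (\<lambda>t. (t / x) powr \<epsilon> / \<epsilon>)"
  have "(\<integral>\<^sup>+ t. ennreal ((t / x) powr \<epsilon> / t) \<partial>(lebesgue_on {0<..<x})) = ennreal (F x - F 0)"
  proof (rule nn_integral_FTC_Ioo)
    show "(F has_real_derivative (t / x) powr \<epsilon> / t) (at t)" if "t \<in> {0<..<x}" for t
      unfolding F_def using that assms
      by (auto intro!: derivative_eq_intros simp: powr_diff field_simps power2_eq_square)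
    show "continuous_on {0..x} F"
      unfolding F_def using assms by (intro continuous_intros continuous_on_powr') auto
  qed (use assms in auto)
  then show ?thesis
    using assms by (simp add: F_def)
qed

section \<open>Powers with values in the extended half-line, and the Luxemburg norm\<close>

lemma ennpowr_ennreal: "0 \<le> u \<Longrightarrow> ennpowr (ennreal u) r = ennreal (u powr r)"
  by (simp add: ennpowr_def)

lemma ennpowr_mono:
  assumes "u \<le> v" "0 \<le> r"
  shows "ennpowr u r \<le> ennpowr v r"
proof (cases "v = \<infinity>")
  case False
  then have "u \<noteq> \<infinity>" using assms(1) by (auto simp: top_unique)
  with False assms show ?thesis
    by (auto simp: ennpowr_def top.not_eq_extremum intro!: ennreal_leI powr_mono2 enn2real_mono)
qed (simp add: ennpowr_def)

lemma luxemburg_norm_le: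
  assumes "0 < l" "(\<integral>\<^sup>+ x. ennpowr (f x / ennreal l) (p x) \<partial>(lebesgue_on J)) \<le> 1"
  shows "luxemburg_norm p J f \<le> ennreal l"
  unfolding luxemburg_norm_def using assms by (intro Inf_lower) auto

lemma luxemburg_norm_less_E:
  assumes "luxemburg_norm p J f < u"
  obtains l where "0 < l" "ennreal l < u"
    "(\<integral>\<^sup>+ x. ennpowr (f x / ennreal l) (p x) \<partial>(lebesgue_on J)) \<le> 1"
  using assms unfolding luxemburg_norm_def Inf_less_iff by auto

text \<open>Transfers modular estimates to norms. The infimum need not be attained and may be
  infinite, so the negated claim is used to pick an admissible \<open>l\<close> below
  \<open>luxemburg_norm q J g / ennreal K\<close>; then \<open>K * l\<close> is admissible for
  \<open>g\<close> and lies below its norm.\<close>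

lemma luxemburg_norm_le_mult:
  assumes "0 < K" and
    "\<And>l. 0 < l \<Longrightarrow> (\<integral>\<^sup>+ x. ennpowr (f x / ennreal l) (p x) \<partial>(lebesgue_on I)) \<le> 1 \<Longrightarrow>
       (\<integral>\<^sup>+ x. ennpowr (g x / ennreal (K * l)) (q x) \<partial>(lebesgue_on J)) \<le> 1"
  shows "luxemburg_norm q J g \<le> ennreal K * luxemburg_norm p I f"
proof (rule ccontr)
  assume "\<not> ?thesis"
  then have less: "ennreal K * luxemburg_norm p I f < luxemburg_norm q J g" by simp
  have eq: "ennreal K * (luxemburg_norm q J g / ennreal K) = luxemburg_norm q J g"
    using assms(1) by (simp add: ennreal_times_divide ennreal_mult_divide_eq mult.commute[of "ennreal K"])
  have "luxemburg_norm p I f < luxemburg_norm q J g / ennreal K"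
  proof (rule ccontr)
    assume "\<not> ?thesis"
    then have "ennreal K * (luxemburg_norm q J g / ennreal K) \<le> ennreal K * luxemburg_norm p I f"
      by (intro mult_left_mono) auto
    with less eq show False by simp
  qed
  then obtain l where l: "0 < l" "ennreal l < luxemburg_norm q J g / ennreal K"
    "(\<integral>\<^sup>+ x. ennpowr (f x / ennreal l) (p x) \<partial>(lebesgue_on I)) \<le> 1"
    by (rule luxemburg_norm_less_E)
  have "luxemburg_norm q J g \<le> ennreal (K * l)"
    using assms l by (intro luxemburg_norm_le) auto
  also have "\<dots> = ennreal K * ennreal l"
    using assms l by (simp add: ennreal_mult)
  also have "\<dots> < ennreal K * (luxemburg_norm q J g / ennreal K)"
    using l assms(1) by (intro ennreal_mult_strict_left_mono) auto
  finally show False using eq by simp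
qed

section \<open>The weight \<open>\<phi>\<close> attached to a nondecreasing bounded exponent\<close>

text \<open>\<open>P\<close> is any upper bound of the exponent; it replaces the variable exponent
  wherever a constant is needed.\<close>

locale increasing_exponent =
  fixes p :: "real \<Rightarrow> real" and P :: real
  assumes ge_1: "x \<in> {0<..<1} \<Longrightarrow> 1 \<le> p x"
    and le_P: "x \<in> {0<..<1} \<Longrightarrow> p x \<le> P"
    and mono: "mono_on {0<..<1} p"
begin

definition \<phi> :: "real \<Rightarrow> real" where
  "\<phi> x = x powr (- recip_conj p x)"

text \<open>A function monotone on \<open>A\<close> is Borel there, and the Lebesgue sigma-algebra
  on \<open>A\<close> only has more sets.\<close>

lemma p_measurable:
  assumes "A \<subseteq> {0<..<1}"
  shows "p \<in> borel_measurable (lebesgue_on A)"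
proof -
  have "p \<in> borel_measurable (restrict_space borel A)"
    using mono_on_subset[OF mono assms] by (rule borel_measurable_mono_on_fnc)
  then show ?thesis
    by (rule borel_measurable_subalgebra[rotated 2]) (auto simp: sets_restrict_space space_restrict_space)
qed

lemma \<phi>_measurable:
  assumes "A \<subseteq> {0<..<1}"
  shows "\<phi> \<in> borel_measurable (lebesgue_on A)"
proof -
  note [measurable] = p_measurable[OF assms]
  have [measurable]: "(\<lambda>x. x) \<in> borel_measurable (lebesgue_on A)"
    by (simp add: borel_measurable_imp_lebesgue_on)
  have "(\<lambda>x. x powr (- (1 - 1 / p x))) \<in> borel_measurable (lebesgue_on A)"
    by measurable
  moreover have "\<phi> x = x powr (- (1 - 1 / p x))" if "x \<in> space (lebesgue_on A)" for x
    using that assms ge_1[of x] by (auto simp: \<phi>_def recip_conj_eq)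
  ultimately show ?thesis
    by (subst measurable_cong)
qed

lemma \<phi>_pos: "x \<in> {0<..<1} \<Longrightarrow> 0 < \<phi> x"
  by (simp add: \<phi>_def)

lemma powr_recip_conj: "x powr recip_conj p x = 1 / \<phi> x"
  by (simp add: \<phi>_def powr_minus_divide)

lemma mult_\<phi>:
  assumes "x \<in> {0<..<1}"
  shows "x * \<phi> x = x powr (1 / p x)"
proof -
  have "x * \<phi> x = x powr 1 * x powr (- recip_conj p x)"
    using assms by (simp add: \<phi>_def)
  also have "\<dots> = x powr (1 / p x)"
    using ge_1[OF assms] by (simp only: powr_add[symmetric] recip_conj_eq) simp
  finally show ?thesis .
qed

text \<open>Dividing by \<open>x * \<phi> x\<close> inside a \<open>p x\<close>-th power is the same
  as dividing by \<open>x\<close> outside it; this is how modulars acquire or lose the factor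
  \<open>1 / x\<close>.\<close>

lemma mult_\<phi>_powr: "x \<in> {0<..<1} \<Longrightarrow> (x * \<phi> x) powr p x = x"
  using ge_1[of x] by (simp add: mult_\<phi> powr_powr)

lemma \<phi>_ge_1:
  assumes "x \<in> {0<..<1}"
  shows "1 \<le> \<phi> x"
proof -
  have "0 \<le> recip_conj p x"
    using ge_1[OF assms] by (simp add: recip_conj_eq)
  then have "x powr 0 \<le> x powr (- recip_conj p x)"
    using assms by (intro powr_mono') auto
  with assms show ?thesis by (simp add: \<phi>_def)
qed

lemma \<phi>_le_inverse:
  assumes "x \<in> {0<..<1}"
  shows "\<phi> x \<le> 1 / x"
proof -
  have "x powr (1 / p x) \<le> x powr 0"
    using ge_1[OF assms] assms by (intro powr_mono') auto
  with assms show ?thesis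
    by (simp add: mult_\<phi>[symmetric] field_simps)
qed

text \<open>With a base in \<open>(0, 1)\<close> a smaller exponent gives a larger power, so
  lowering the exponent from \<open>1 / p x\<close> to \<open>1 / p y\<close> and then raising the
  base from \<open>x\<close> to \<open>y\<close> both increase
  \<open>x powr (1 / p x)\<close>.\<close>

lemma mult_\<phi>_mono:
  assumes "x \<in> {0<..<1}" "y \<in> {0<..<1}" "x \<le> y"
  shows "x * \<phi> x \<le> y * \<phi> y"
proof -
  have "p x \<le> p y" using mono_onD[OF mono assms] .
  then have le: "1 / p y \<le> 1 / p x"
    using ge_1[OF assms(1)] by (simp add: frac_le)
  have "x powr (1 / p x) \<le> x powr (1 / p y)"
    using assms le by (intro powr_mono') auto
  also have "\<dots> \<le> y powr (1 / p y)"
    using assms ge_1[OF assms(2)] by (intro powr_mono2) auto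
  finally show ?thesis
    using assms by (simp add: mult_\<phi>)
qed

lemma almost_decreasing_iff:
  "almost_decreasing_condition p \<longleftrightarrow>
     (\<exists>\<epsilon>>0. \<exists>C>0. \<forall>s t. 0 < s \<longrightarrow> s \<le> t \<longrightarrow> t < 1 \<longrightarrow> \<phi> t \<le> C * (s / t) powr \<epsilon> * \<phi> s)"
proof -
  have eq: "x powr (- recip_conj p x + \<epsilon>) = \<phi> x * x powr \<epsilon>" for x \<epsilon>
    by (simp only: \<phi>_def powr_add)
  have "t powr (- recip_conj p t + \<epsilon>) \<le> C * s powr (- recip_conj p s + \<epsilon>)
      \<longleftrightarrow> \<phi> t \<le> C * (s / t) powr \<epsilon> * \<phi> s" if "0 < s" "s \<le> t" for s t C \<epsilon>
    unfolding eq using that by (simp add: powr_divide field_simps)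
  then show ?thesis
    unfolding almost_decreasing_condition_def by blast
qed

lemma tail_integral_iff:
  "tail_integral_condition p \<longleftrightarrow>
     (\<exists>C>0. \<forall>a\<in>{0<..<1}. (\<integral>\<^sup>+ x. ennreal (\<phi> x / x) \<partial>(lebesgue_on {a<..<1})) \<le> ennreal (C * \<phi> a))"
  by (simp add: tail_integral_condition_def \<phi>_def)

lemma tail_modular_iff:
  "tail_modular_condition p \<longleftrightarrow>
     (\<exists>C>0. \<forall>a\<in>{0<..<1}.
        (\<integral>\<^sup>+ x. ennreal ((\<phi> x / \<phi> a) powr p x / x) \<partial>(lebesgue_on {a<..<1})) \<le> ennreal C)"
  by (simp add: tail_modular_condition_def powr_recip_conj flip: \<phi>_def)

section \<open>From the integral conditions to power decay\<close>

text \<open>Halving points are chained from \<open>s\<close> towards \<open>t\<close>. Along the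
  chain \<open>\<phi> x * x powr \<epsilon>\<close> does not increase, and only the last, incomplete
  step costs a constant.\<close>

lemma halving_imp_almost_decreasing:
  assumes K: "1 < K"
    and halving: "\<And>a. 0 < a \<Longrightarrow> K * a \<le> 1 \<Longrightarrow> \<exists>b\<in>{a<..<K * a}. \<phi> b \<le> \<phi> a / 2"
  shows "almost_decreasing_condition p"
proof -
  \<comment> \<open>With this exponent, moving by a factor of at most \<open>K\<close> raises
    \<open>x powr \<epsilon>\<close> by a factor of at most 2, which one halving of
    \<open>\<phi>\<close> compensates.\<close>
  define \<epsilon> where "\<epsilon> = log K 2"
  have \<epsilon>: "0 < \<epsilon>" using K by (simp add: \<epsilon>_def)
  have K\<epsilon>: "K powr \<epsilon> = 2" using K by (simp add: \<epsilon>_def)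
  have powr_le: "y powr \<epsilon> \<le> 2 * x powr \<epsilon>" if "0 < x" "0 < y" "y \<le> K * x" for x y
  proof -
    have "y powr \<epsilon> \<le> (K * x) powr \<epsilon>"
      using that \<epsilon> by (intro powr_mono2) auto
    with that K K\<epsilon> show ?thesis by (simp add: powr_mult)
  qed
  \<comment> \<open>Here both points lie in \<open>(1 / K, 1)\<close>, where \<open>\<phi>\<close>
    stays between 1 and \<open>K\<close>.\<close>
  have far: "\<phi> t * t powr \<epsilon> \<le> 2 * K * (\<phi> s * s powr \<epsilon>)"
    if s: "s \<in> {0<..<1}" and t: "t \<in> {s..<1}" and K_s: "\<not> K * s \<le> 1" for s t
  proof -
    have "\<phi> t \<le> 1 / t" using s t by (intro \<phi>_le_inverse) auto
    also have "\<dots> \<le> 1 / s" using s t by (simp add: frac_le)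
    also have "\<dots> \<le> K" using s K_s by (simp add: field_simps)
    also have "\<dots> \<le> K * \<phi> s" using K \<phi>_ge_1[OF s] by simp
    finally have "\<phi> t * t powr \<epsilon> \<le> (K * \<phi> s) * (2 * s powr \<epsilon>)"
      using s t K_s K \<phi>_pos[OF s] by (intro mult_mono powr_le) auto
    then show ?thesis by (simp add: mult_ac)
  qed
  txt \<open>Since \<open>\<phi> \<ge> 1\<close>, the number of halvings starting from \<open>s\<close> is at most \<open>n\<close>.\<close>
  have main: "\<phi> t * t powr \<epsilon> \<le> 2 * K * (\<phi> s * s powr \<epsilon>)"
    if "\<phi> s \<le> 2 ^ n" "0 < s" "s \<le> t" "t < 1" for n s t
    using that
  proof (induction n arbitrary: s)
    case base: 0
    \<comment> \<open>Now \<open>\<phi> s \<le> 1\<close>, so a further halving would push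
      \<open>\<phi>\<close> below 1.\<close>
    have "\<not> K * s \<le> 1"
    proof
      assume "K * s \<le> 1"
      then obtain b where b: "b \<in> {s<..<K * s}" "\<phi> b \<le> \<phi> s / 2"
        using halving base.prems by blast
      with \<open>K * s \<le> 1\<close> have "1 \<le> \<phi> b" using base.prems by (intro \<phi>_ge_1) auto
      with b base.prems show False by simp
    qed
    with base.prems show ?case by (intro far) auto
  next
    case (Suc n)
    have s: "s \<in> {0<..<1}" and t: "t \<in> {0<..<1}" using Suc.prems by auto
    show ?case
    proof (cases "K * s \<le> 1")
      case True
      then obtain b where b: "b \<in> {s<..<K * s}" "\<phi> b \<le> \<phi> s / 2"
        using halving Suc.prems by blast
      have b01: "b \<in> {0<..<1}" using b(1) True s by auto
      show ?thesis
      proof (cases "b \<le> t")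
        case True
        \<comment> \<open>A complete step from \<open>s\<close> to \<open>b\<close> loses nothing,
          so the constant \<open>2 * K\<close> does not grow with \<open>n\<close>.\<close>
        have "\<phi> t * t powr \<epsilon> \<le> 2 * K * (\<phi> b * b powr \<epsilon>)"
          using b Suc.prems True b01 by (intro Suc.IH) auto
        also have "\<dots> \<le> 2 * K * (\<phi> s / 2 * (2 * s powr \<epsilon>))"
          using b b01 s K \<phi>_pos[OF s] \<phi>_pos[OF b01]
          by (intro mult_left_mono mult_mono powr_le) auto
        finally show ?thesis by simp
      next
        case False
        \<comment> \<open>The halving point lies beyond \<open>t\<close>, and \<open>\<phi>\<close>
          need not be monotone between \<open>s\<close> and \<open>b\<close>. Monotonicity of
          \<open>x * \<phi> x\<close> carries the bound back from \<open>b\<close> to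
          \<open>t\<close> at the price of \<open>b / t\<close>, which is at most
          \<open>K\<close>.\<close>
        have "t * \<phi> t \<le> b * \<phi> b"
          using False t b01 by (intro mult_\<phi>_mono) auto
        also have "\<dots> \<le> (K * t) * (\<phi> s / 2)"
        proof (intro mult_mono)
          have "K * s \<le> K * t" using Suc.prems K by simp
          with b show "b \<le> K * t" by auto
        qed (use b b01 \<phi>_pos[OF b01] K t in auto)
        finally have "\<phi> t \<le> K * (\<phi> s / 2)" using t by simp
        then have "\<phi> t * t powr \<epsilon> \<le> (K * (\<phi> s / 2)) * (2 * s powr \<epsilon>)"
          using False b s t K \<phi>_pos[OF s] by (intro mult_mono powr_le) auto
        also have "\<dots> \<le> 2 * K * (\<phi> s * s powr \<epsilon>)"
          using K \<phi>_pos[OF s] by simp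
        finally show ?thesis .
      qed
    next
      case False
      with Suc.prems s show ?thesis by (intro far) auto
    qed
  qed
  have "\<phi> t \<le> (2 * K) * (s / t) powr \<epsilon> * \<phi> s" if "0 < s" "s \<le> t" "t < 1" for s t
  proof -
    obtain n where "\<phi> s \<le> 2 ^ n"
      using real_arch_pow[of 2 "\<phi> s"] by (auto intro: less_imp_le)
    then have "\<phi> t * t powr \<epsilon> \<le> 2 * K * (\<phi> s * s powr \<epsilon>)"
      using that by (intro main)
    with that show ?thesis
      by (simp add: powr_divide field_simps)
  qed
  then show ?thesis
    unfolding almost_decreasing_iff using K \<epsilon>
    by (intro exI[of _ \<epsilon>] conjI exI[of _ "2 * K"]) auto
qed

text \<open>Serves both integral conditions: \<open>F a x / x\<close> is the integrand and
  \<open>m a\<close> the scale of its bound. Without a halving point in \<open>(a, K * a)\<close>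
  the integrand is at least \<open>c * m a / x\<close> there, so the integral is at least
  \<open>c * m a * ln K\<close>.\<close>

lemma integral_bound_imp_almost_decreasing:
  fixes F :: "real \<Rightarrow> real \<Rightarrow> real" and m :: "real \<Rightarrow> real"
  assumes C: "0 < C" and c: "0 < c" and m: "\<And>a. a \<in> {0<..<1} \<Longrightarrow> 0 < m a"
    and int: "\<And>a. a \<in> {0<..<1} \<Longrightarrow>
        (\<integral>\<^sup>+ x. ennreal (F a x / x) \<partial>(lebesgue_on {a<..<1})) \<le> ennreal (C * m a)"
    and low: "\<And>a x. a \<in> {0<..<1} \<Longrightarrow> x \<in> {a<..<1} \<Longrightarrow> \<phi> a / 2 < \<phi> x \<Longrightarrow> c * m a \<le> F a x"
  shows "almost_decreasing_condition p"
proof -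
  \<comment> \<open>Chosen so that \<open>c * ln K = C + c\<close>, which exceeds
    \<open>C\<close>.\<close>
  define K where "K = exp (C / c + 1)"
  have K: "1 < K" using C c by (simp add: K_def add_pos_pos)
  have "\<exists>b\<in>{a<..<K * a}. \<phi> b \<le> \<phi> a / 2" if a: "0 < a" "K * a \<le> 1" for a
  proof (rule ccontr)
    assume "\<not> ?thesis"
    then have big: "\<phi> a / 2 < \<phi> x" if "x \<in> {a<..<K * a}" for x
      using that by force
    have aK: "a < K * a" using a K by simp
    then have "a < 1" using a(2) by (rule order.strict_trans2)
    with a have a1: "a \<in> {0<..<1}" by simp
    have "ennreal (c * m a * ln K)
        = ennreal (c * m a) * (\<integral>\<^sup>+ x. ennreal (1 / x) \<partial>(lebesgue_on {a<..<K * a}))"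
      using a aK c m[OF a1] K by (simp add: nn_integral_inverse_Ioo ennreal_mult)
    also have "\<dots> = (\<integral>\<^sup>+ x. ennreal (c * m a) * ennreal (1 / x) \<partial>(lebesgue_on {a<..<K * a}))"
      by (subst nn_integral_cmult) (auto intro!: borel_measurable_imp_lebesgue_on)
    also have "\<dots> \<le> (\<integral>\<^sup>+ x. ennreal (F a x / x) \<partial>(lebesgue_on {a<..<1}))"
    proof (rule nn_integral_lebesgue_on_mono_set)
      show "ennreal (c * m a) * ennreal (1 / x) \<le> ennreal (F a x / x)" if "x \<in> {a<..<K * a}" for x
      proof -
        have "c * m a \<le> F a x"
          using that a a1 big[OF that] by (intro low) auto
        with that a c m[OF a1] show ?thesis
          by (subst ennreal_mult[symmetric]) (auto intro!: ennreal_leI divide_right_mono)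
      qed
    qed (use a in auto)
    also have "\<dots> \<le> ennreal (C * m a)" by (rule int[OF a1])
    finally have "c * ln K \<le> C"
      using C m[OF a1] by (simp add: mult_ac)
    with c show False by (simp add: K_def distrib_left)
  qed
  with K show ?thesis by (rule halving_imp_almost_decreasing)
qed

lemma tail_integral_imp_almost_decreasing:
  assumes "tail_integral_condition p"
  shows "almost_decreasing_condition p"
proof -
  obtain C where C: "0 < C" and int: "\<And>a. a \<in> {0<..<1} \<Longrightarrow>
      (\<integral>\<^sup>+ x. ennreal (\<phi> x / x) \<partial>(lebesgue_on {a<..<1})) \<le> ennreal (C * \<phi> a)"
    using assms unfolding tail_integral_iff by blast
  show ?thesis
    by (rule integral_bound_imp_almost_decreasing[where c = "1 / 2" and m = \<phi>, OF C _ _ int])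
      (auto simp: \<phi>_pos)
qed

text \<open>Where \<open>\<phi> x\<close> exceeds \<open>\<phi> a / 2\<close>, the
  \<open>p x\<close>-th power of their ratio is at least \<open>(1 / 2) powr P\<close>, which serves
  as the lower constant \<open>c\<close>.\<close>

lemma tail_modular_imp_almost_decreasing:
  assumes "tail_modular_condition p"
  shows "almost_decreasing_condition p"
proof -
  obtain C where C: "0 < C" and int: "\<And>a. a \<in> {0<..<1} \<Longrightarrow>
      (\<integral>\<^sup>+ x. ennreal ((\<phi> x / \<phi> a) powr p x / x) \<partial>(lebesgue_on {a<..<1})) \<le> ennreal (C * 1)"
    using assms unfolding tail_modular_iff by auto
  show ?thesis
  proof (rule integral_bound_imp_almost_decreasing[where m = "\<lambda>_. 1", OF C _ _ int])
    show "0 < (1 / 2 :: real) powr P" by simp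
    fix a x :: real assume a: "a \<in> {0<..<1}" and x: "x \<in> {a<..<1}" and big: "\<phi> a / 2 < \<phi> x"
    have "(1 / 2) powr P \<le> (1 / 2) powr p x"
      using a x le_P[of x] by (intro powr_mono') auto
    also have "\<dots> \<le> (\<phi> x / \<phi> a) powr p x"
      using a x big ge_1[of x] \<phi>_pos[OF a] by (intro powr_mono2) (auto simp: field_simps)
    finally show "(1 / 2) powr P * 1 \<le> (\<phi> x / \<phi> a) powr p x" by simp
  qed simp_all
qed

section \<open>From power decay back to the integral conditions\<close>

lemma almost_decreasing_imp_tail_integral:
  assumes "almost_decreasing_condition p"
  shows "tail_integral_condition p"
proof -
  obtain \<epsilon> C where \<epsilon>: "0 < \<epsilon>" and C: "0 < C"
    and dec: "\<And>s t. 0 < s \<Longrightarrow> s \<le> t \<Longrightarrow> t < 1 \<Longrightarrow> \<phi> t \<le> C * (s / t) powr \<epsilon> * \<phi> s"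
    using assms unfolding almost_decreasing_iff by blast
  have "(\<integral>\<^sup>+ x. ennreal (\<phi> x / x) \<partial>(lebesgue_on {a<..<1})) \<le> ennreal (C / \<epsilon> * \<phi> a)"
    if a: "a \<in> {0<..<1}" for a
  proof -
    have "(\<integral>\<^sup>+ x. ennreal (\<phi> x / x) \<partial>(lebesgue_on {a<..<1}))
        \<le> (\<integral>\<^sup>+ x. ennreal (C * \<phi> a) * ennreal ((a / x) powr \<epsilon> / x) \<partial>(lebesgue_on {a<..<1}))"
    proof (rule nn_integral_lebesgue_on_mono_set)
      fix x assume x: "x \<in> {a<..<1}"
      then have "\<phi> x / x \<le> C * \<phi> a * ((a / x) powr \<epsilon> / x)"
        using dec[of a x] a by (simp add: divide_right_mono mult_ac)
      then show "ennreal (\<phi> x / x) \<le> ennreal (C * \<phi> a) * ennreal ((a / x) powr \<epsilon> / x)"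
        using x a C \<phi>_pos[OF a] by (subst ennreal_mult[symmetric]) (auto intro!: ennreal_leI)
    qed auto
    also have "\<dots> = ennreal (C * \<phi> a) * (\<integral>\<^sup>+ x. ennreal ((a / x) powr \<epsilon> / x) \<partial>(lebesgue_on {a<..<1}))"
      by (subst nn_integral_cmult) (auto intro!: borel_measurable_imp_lebesgue_on)
    also have "\<dots> \<le> ennreal (C * \<phi> a) * ennreal (1 / \<epsilon>)"
      using a \<epsilon> by (intro mult_left_mono nn_integral_powr_right_le) auto
    also have "\<dots> = ennreal (C / \<epsilon> * \<phi> a)"
      using C \<epsilon> \<phi>_pos[OF a] by (simp add: ennreal_mult[symmetric])
    finally show ?thesis .
  qed
  with C \<epsilon> show ?thesis
    unfolding tail_integral_iff by (intro exI[of _ "C / \<epsilon>"]) auto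
qed

lemma almost_decreasing_imp_tail_modular:
  assumes "almost_decreasing_condition p"
  shows "tail_modular_condition p"
proof -
  obtain \<epsilon> C0 where \<epsilon>: "0 < \<epsilon>" and C0: "0 < C0"
    and dec0: "\<And>s t. 0 < s \<Longrightarrow> s \<le> t \<Longrightarrow> t < 1 \<Longrightarrow> \<phi> t \<le> C0 * (s / t) powr \<epsilon> * \<phi> s"
    using assms unfolding almost_decreasing_iff by blast
  \<comment> \<open>A constant of at least 1 ensures
    \<open>C powr p x \<le> C powr P\<close>.\<close>
  define C where "C = max 1 C0"
  have C: "1 \<le> C" by (simp add: C_def)
  have "(\<integral>\<^sup>+ x. ennreal ((\<phi> x / \<phi> a) powr p x / x) \<partial>(lebesgue_on {a<..<1}))
      \<le> ennreal (C powr P / \<epsilon>)"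
    if a: "a \<in> {0<..<1}" for a
  proof -
    have "(\<integral>\<^sup>+ x. ennreal ((\<phi> x / \<phi> a) powr p x / x) \<partial>(lebesgue_on {a<..<1}))
        \<le> (\<integral>\<^sup>+ x. ennreal (C powr P) * ennreal ((a / x) powr \<epsilon> / x) \<partial>(lebesgue_on {a<..<1}))"
    proof (rule nn_integral_lebesgue_on_mono_set)
      fix x assume x: "x \<in> {a<..<1}"
      then have x1: "x \<in> {0<..<1}" using a by auto
      have small: "(a / x) powr \<epsilon> \<le> 1"
        using a x \<epsilon> by (intro powr_le1) auto
      have "\<phi> x \<le> C0 * (a / x) powr \<epsilon> * \<phi> a"
        using x a by (intro dec0) auto
      also have "\<dots> \<le> C * (a / x) powr \<epsilon> * \<phi> a"
        using \<phi>_pos[OF a] by (intro mult_right_mono) (auto simp: C_def)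
      finally have "\<phi> x / \<phi> a \<le> C * (a / x) powr \<epsilon>"
        using \<phi>_pos[OF a] by (simp add: field_simps)
      then have "(\<phi> x / \<phi> a) powr p x \<le> (C * (a / x) powr \<epsilon>) powr p x"
        using ge_1[OF x1] \<phi>_pos[OF a] \<phi>_pos[OF x1] by (intro powr_mono2) auto
      also have "\<dots> = C powr p x * ((a / x) powr \<epsilon>) powr p x"
        using C by (simp add: powr_mult)
      \<comment> \<open>A number in \<open>[0, 1]\<close> only gets smaller when raised to the power
        \<open>p x \<ge> 1\<close>, so the decay may be kept with exponent 1.\<close>
      also have "\<dots> \<le> C powr P * ((a / x) powr \<epsilon>) powr 1"
        using C small ge_1[OF x1] le_P[OF x1] by (intro mult_mono powr_mono powr_mono') auto
      finally have "(\<phi> x / \<phi> a) powr p x / x \<le> C powr P * ((a / x) powr \<epsilon> / x)"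
        using x1 by (simp add: divide_right_mono)
      then show "ennreal ((\<phi> x / \<phi> a) powr p x / x) \<le> ennreal (C powr P) * ennreal ((a / x) powr \<epsilon> / x)"
        using x1 by (subst ennreal_mult[symmetric]) (auto intro!: ennreal_leI)
    qed auto
    also have "\<dots> = ennreal (C powr P) * (\<integral>\<^sup>+ x. ennreal ((a / x) powr \<epsilon> / x) \<partial>(lebesgue_on {a<..<1}))"
      by (subst nn_integral_cmult) (auto intro!: borel_measurable_imp_lebesgue_on)
    also have "\<dots> \<le> ennreal (C powr P) * ennreal (1 / \<epsilon>)"
      using a \<epsilon> by (intro mult_left_mono nn_integral_powr_right_le) auto
    also have "\<dots> = ennreal (C powr P / \<epsilon>)"
      using \<epsilon> by (simp add: ennreal_mult[symmetric])
    finally show ?thesis .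
  qed
  with C \<epsilon> show ?thesis
    unfolding tail_modular_iff by (intro exI[of _ "C powr P / \<epsilon>"]) auto
qed

section \<open>Modular and norm of \<open>1 / x\<close> on \<open>(a, 1)\<close>\<close>

text \<open>By \<open>mult_\<phi>_powr\<close>, \<open>x powr (- p x)\<close> equals
  \<open>\<phi> x powr p x / x\<close>. The constant is split off as \<open>c powr p x\<close> so
  that it can be compared with a constant in either direction.\<close>

lemma ennpowr_inverse_eq:
  assumes a: "a \<in> {0<..<1}" and x: "x \<in> {a<..<1}" and c: "0 < c"
  shows "ennpowr (ennreal (inverse x) / ennreal (c * \<phi> a)) (p x)
    = ennreal (((\<phi> x / \<phi> a) powr p x / x) / c powr p x)"
proof -
  have x1: "x \<in> {0<..<1}" using a x by auto
  note pos = \<phi>_pos[OF a] \<phi>_pos[OF x1]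
  have "(\<phi> x / \<phi> a) powr p x / x / c powr p x
      = (\<phi> x / \<phi> a) powr p x / (x * \<phi> x) powr p x / c powr p x"
    using mult_\<phi>_powr[OF x1] by simp
  also have "\<dots> = ((\<phi> x / \<phi> a) / (x * \<phi> x) / c) powr p x"
    by (simp only: powr_divide)
  also have "(\<phi> x / \<phi> a) / (x * \<phi> x) / c = inverse x / (c * \<phi> a)"
    using pos x1 c by (simp add: field_simps)
  finally show ?thesis
    using pos x1 c by (simp add: divide_ennreal ennpowr_ennreal)
qed

lemma tail_modular_integrand_measurable:
  assumes "a \<in> {0<..<1}"
  shows "(\<lambda>x. (\<phi> x / \<phi> a) powr p x / x) \<in> borel_measurable (lebesgue_on {a<..<1})"
proof -
  have "{a<..<1} \<subseteq> {0<..<1}" using assms by auto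
  note [measurable] = p_measurable[OF this] \<phi>_measurable[OF this]
  have [measurable]: "(\<lambda>x. x) \<in> borel_measurable (lebesgue_on {a<..<1})"
    by (simp add: borel_measurable_imp_lebesgue_on)
  show ?thesis by measurable
qed

lemma tail_modular_imp_tail_norm:
  assumes "tail_modular_condition p"
  shows "tail_norm_condition p"
proof -
  obtain C0 where C0: "0 < C0" and int: "\<And>a. a \<in> {0<..<1} \<Longrightarrow>
      (\<integral>\<^sup>+ x. ennreal ((\<phi> x / \<phi> a) powr p x / x) \<partial>(lebesgue_on {a<..<1})) \<le> ennreal C0"
    using assms unfolding tail_modular_iff by blast
  \<comment> \<open>Since \<open>C \<ge> 1\<close>, also \<open>C powr p x \<ge> C\<close>; scaling
    by \<open>C\<close> therefore divides the modular by at least \<open>C\<close>, which brings it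
    down to 1.\<close>
  define C where "C = max 1 C0"
  have C: "1 \<le> C" "C0 \<le> C" by (simp_all add: C_def)
  have "luxemburg_norm p {a<..<1} (\<lambda>x. ennreal (inverse x)) \<le> ennreal (C * \<phi> a)"
    if a: "a \<in> {0<..<1}" for a
  proof (rule luxemburg_norm_le)
    note tail_modular_integrand_measurable[OF a, measurable]
    have "(\<integral>\<^sup>+ x. ennpowr (ennreal (inverse x) / ennreal (C * \<phi> a)) (p x) \<partial>(lebesgue_on {a<..<1}))
        \<le> (\<integral>\<^sup>+ x. ennreal (1 / C) * ennreal ((\<phi> x / \<phi> a) powr p x / x) \<partial>(lebesgue_on {a<..<1}))"
    proof (rule nn_integral_lebesgue_on_mono_set)
      fix x assume x: "x \<in> {a<..<1}"
      then have x1: "x \<in> {0<..<1}" using a by auto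
      have "C powr 1 \<le> C powr p x"
        using C ge_1[OF x1] by (intro powr_mono) auto
      then have "(\<phi> x / \<phi> a) powr p x / x / C powr p x \<le> (\<phi> x / \<phi> a) powr p x / x / C"
        using C x1 by (intro divide_left_mono) auto
      also have "\<dots> = 1 / C * ((\<phi> x / \<phi> a) powr p x / x)" by simp
      finally have "(\<phi> x / \<phi> a) powr p x / x / C powr p x \<le> 1 / C * ((\<phi> x / \<phi> a) powr p x / x)" .
      then show "ennpowr (ennreal (inverse x) / ennreal (C * \<phi> a)) (p x)
          \<le> ennreal (1 / C) * ennreal ((\<phi> x / \<phi> a) powr p x / x)"
        using a x x1 C
        by (subst ennpowr_inverse_eq, simp_all only: ennreal_mult[symmetric])
          (auto intro!: ennreal_leI simp: ennreal_mult[symmetric])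
    qed auto
    also have "\<dots> = ennreal (1 / C) *
        (\<integral>\<^sup>+ x. ennreal ((\<phi> x / \<phi> a) powr p x / x) \<partial>(lebesgue_on {a<..<1}))"
      by (rule nn_integral_cmult) measurable
    also have "\<dots> \<le> ennreal (1 / C) * ennreal C"
      using C by (intro mult_left_mono order.trans[OF int[OF a]] ennreal_leI) auto
    also have "\<dots> = 1"
      using C by (simp add: ennreal_mult[symmetric])
    finally show "(\<integral>\<^sup>+ x. ennpowr (ennreal (inverse x) / ennreal (C * \<phi> a)) (p x)
        \<partial>(lebesgue_on {a<..<1})) \<le> 1" .
  qed (use C \<phi>_pos[OF a] in auto)
  with C show ?thesis
    unfolding tail_norm_condition_def \<phi>_def[symmetric] by (intro exI[of _ C]) auto
qed

lemma tail_norm_imp_tail_modular: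
  assumes "tail_norm_condition p"
  shows "tail_modular_condition p"
proof -
  obtain C where C: "0 < C" and norm: "\<And>a. a \<in> {0<..<1} \<Longrightarrow>
      luxemburg_norm p {a<..<1} (\<lambda>x. ennreal (inverse x)) \<le> ennreal (C * \<phi> a)"
    using assms unfolding tail_norm_condition_def \<phi>_def by blast
  \<comment> \<open>The infimum defining the norm need not be attained; a strictly larger constant
    leaves room for an admissible \<open>l\<close> below \<open>D * \<phi> a\<close>.\<close>
  define D where "D = C + 1"
  have D: "1 \<le> D" using C by (simp add: D_def)
  have "(\<integral>\<^sup>+ x. ennreal ((\<phi> x / \<phi> a) powr p x / x) \<partial>(lebesgue_on {a<..<1})) \<le> ennreal (D powr P)"
    if a: "a \<in> {0<..<1}" for a
  proof -
    note tail_modular_integrand_measurable[OF a, measurable]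
    have sub: "{a<..<1} \<subseteq> {0<..<1}" using a by auto
    note p_measurable[OF sub, measurable]
    have "ennreal (C * \<phi> a) < ennreal (D * \<phi> a)"
      using C \<phi>_pos[OF a] by (intro ennreal_lessI) (auto simp: D_def)
    with norm[OF a] have "luxemburg_norm p {a<..<1} (\<lambda>x. ennreal (inverse x)) < ennreal (D * \<phi> a)"
      by (rule order.strict_trans1)
    then obtain l where l: "0 < l" "ennreal l < ennreal (D * \<phi> a)"
      "(\<integral>\<^sup>+ x. ennpowr (ennreal (inverse x) / ennreal l) (p x) \<partial>(lebesgue_on {a<..<1})) \<le> 1"
      by (rule luxemburg_norm_less_E)
    have "(\<integral>\<^sup>+ x. ennreal ((\<phi> x / \<phi> a) powr p x / x) \<partial>(lebesgue_on {a<..<1}))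
        \<le> (\<integral>\<^sup>+ x. ennreal (D powr P) * ennreal ((\<phi> x / \<phi> a) powr p x / x / D powr p x)
              \<partial>(lebesgue_on {a<..<1}))"
    proof (rule nn_integral_lebesgue_on_mono_set)
      fix x assume x: "x \<in> {a<..<1}"
      then have x1: "x \<in> {0<..<1}" using a by auto
      have "D powr p x \<le> D powr P"
        using D le_P[OF x1] by (intro powr_mono) auto
      then have "(\<phi> x / \<phi> a) powr p x / x * D powr p x \<le> (\<phi> x / \<phi> a) powr p x / x * D powr P"
        using x1 by (intro mult_left_mono) auto
      then have "(\<phi> x / \<phi> a) powr p x / x \<le> D powr P * ((\<phi> x / \<phi> a) powr p x / x / D powr p x)"
        using D by (simp only: times_divide_eq_right pos_le_divide_eq powr_gt_zero mult.commute[of "D powr P"])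
          simp
      then show "ennreal ((\<phi> x / \<phi> a) powr p x / x)
          \<le> ennreal (D powr P) * ennreal ((\<phi> x / \<phi> a) powr p x / x / D powr p x)"
        using x1 by (subst ennreal_mult[symmetric]) (auto intro!: ennreal_leI)
    qed auto
    also have "\<dots> = ennreal (D powr P) *
        (\<integral>\<^sup>+ x. ennreal ((\<phi> x / \<phi> a) powr p x / x / D powr p x) \<partial>(lebesgue_on {a<..<1}))"
      by (rule nn_integral_cmult) measurable
    also have "\<dots> \<le> ennreal (D powr P) *
        (\<integral>\<^sup>+ x. ennpowr (ennreal (inverse x) / ennreal l) (p x) \<partial>(lebesgue_on {a<..<1}))"
    proof (intro mult_left_mono nn_integral_lebesgue_on_mono_set)
      fix x assume x: "x \<in> {a<..<1}"
      have "ennreal ((\<phi> x / \<phi> a) powr p x / x / D powr p x)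
          = ennpowr (ennreal (inverse x) / ennreal (D * \<phi> a)) (p x)"
        using a x D by (simp add: ennpowr_inverse_eq)
      also have "\<dots> \<le> ennpowr (ennreal (inverse x) / ennreal l) (p x)"
      proof (rule ennpowr_mono)
        have "l < D * \<phi> a" using l by (simp add: ennreal_less_iff)
        then show "ennreal (inverse x) / ennreal (D * \<phi> a) \<le> ennreal (inverse x) / ennreal l"
          using x a l by (auto simp: divide_ennreal intro!: ennreal_leI divide_left_mono)
      qed (use x a ge_1[of x] in auto)
      finally show "ennreal ((\<phi> x / \<phi> a) powr p x / x / D powr p x)
          \<le> ennpowr (ennreal (inverse x) / ennreal l) (p x)" .
    qed auto
    also have "\<dots> \<le> ennreal (D powr P) * 1"
      using l by (intro mult_left_mono) auto
    finally show ?thesis by simp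
  qed
  with D show ?thesis
    unfolding tail_modular_iff by (intro exI[of _ "D powr P"]) auto
qed

section \<open>Necessity: the Hardy inequality tested on indicators\<close>

text \<open>The indicator of \<open>(0, a)\<close> has norm at most \<open>a * \<phi> a\<close>,
  while its average is \<open>a / x\<close> on \<open>(a, 1)\<close>; dividing by \<open>a\<close>
  leaves the bound for \<open>1 / x\<close>.\<close>

lemma hardy_imp_tail_norm:
  assumes "hardy_inequality p"
  shows "tail_norm_condition p"
proof -
  obtain C where C: "0 < C" and hardy: "\<And>f. f \<in> borel_measurable (lebesgue_on {0<..<1}) \<Longrightarrow>
      (\<And>x. x \<in> {0<..<1} \<Longrightarrow> 0 \<le> f x) \<Longrightarrow>
      luxemburg_norm p {0<..<1} (hardy_average f)
        \<le> ennreal C * luxemburg_norm p {0<..<1} (\<lambda>x. ennreal (f x))"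
    using assms unfolding hardy_inequality_def by blast
  have "luxemburg_norm p {a<..<1} (\<lambda>x. ennreal (inverse x)) \<le> ennreal (C * \<phi> a)"
    if a: "a \<in> {0<..<1}" for a
  proof -
    define f :: "real \<Rightarrow> real" where "f = indicator {0<..<a}"
    have f_norm: "luxemburg_norm p {0<..<1} (\<lambda>x. ennreal (f x)) \<le> ennreal (a * \<phi> a)"
    proof (rule luxemburg_norm_le)
      have "(\<integral>\<^sup>+ x. ennpowr (ennreal (f x) / ennreal (a * \<phi> a)) (p x) \<partial>(lebesgue_on {0<..<1}))
          \<le> (\<integral>\<^sup>+ x. ennreal (1 / a) * indicator {0<..<a} x \<partial>(lebesgue_on {0<..<1}))"
      proof (rule nn_integral_lebesgue_on_mono_set)
        fix x :: real assume x: "x \<in> {0<..<1}"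
        show "ennpowr (ennreal (f x) / ennreal (a * \<phi> a)) (p x) \<le> ennreal (1 / a) * indicator {0<..<a} x"
        proof (cases "x < a")
          case True
          have "p x \<le> p a" using mono_onD[OF mono x a] True by simp
          \<comment> \<open>As \<open>p x \<le> p a\<close> to the left of \<open>a\<close>, the
            \<open>p x\<close>-th power of \<open>a powr (1 / p a)\<close> is at least
            \<open>a\<close>. The modular integrand is thus at most \<open>1 / a\<close> on an
            interval of length \<open>a\<close>.\<close>
          have "a powr 1 \<le> a powr (1 / p a * p x)"
            using a \<open>p x \<le> p a\<close> ge_1[OF a] by (intro powr_mono') (auto simp: field_simps)
          also have "\<dots> = (a * \<phi> a) powr p x"
            using a by (simp add: mult_\<phi> powr_powr)
          finally have "(1 / (a * \<phi> a)) powr p x \<le> 1 / a"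
            using a \<phi>_pos[OF a] by (simp add: powr_divide frac_le)
          moreover have "ennreal 1 / ennreal (a * \<phi> a) = ennreal (1 / (a * \<phi> a))"
            using a \<phi>_pos[OF a] by (intro divide_ennreal) auto
          ultimately show ?thesis
            using x True a \<phi>_pos[OF a] by (simp add: f_def ennpowr_ennreal ennreal_leI)
        next
          case False
          then show ?thesis by (simp add: f_def ennpowr_def)
        qed
      qed auto
      also have "\<dots> = (\<integral>\<^sup>+ x. ennreal (1 / a) \<partial>(lebesgue_on {0<..<a}))"
        using a by (intro nn_integral_lebesgue_on_subset[symmetric]) auto
      also have "\<dots> = 1"
        using a by (simp add: emeasure_restrict_space ennreal_mult[symmetric])
      finally show "(\<integral>\<^sup>+ x. ennpowr (ennreal (f x) / ennreal (a * \<phi> a)) (p x)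
          \<partial>(lebesgue_on {0<..<1})) \<le> 1" .
    qed (use a \<phi>_pos[OF a] in auto)
    have average: "hardy_average f x = ennreal (a / x)" if x: "x \<in> {a<..<1}" for x
    proof -
      have "(\<integral>\<^sup>+ t. ennreal (f t) \<partial>(lebesgue_on {0<..<x}))
          = (\<integral>\<^sup>+ t. 1 * indicator {0<..<a} t \<partial>(lebesgue_on {0<..<x}))"
        by (intro nn_integral_cong) (auto simp: f_def split: split_indicator)
      also have "\<dots> = (\<integral>\<^sup>+ t. 1 \<partial>(lebesgue_on {0<..<a}))"
        using x by (intro nn_integral_lebesgue_on_subset[symmetric]) auto
      also have "\<dots> = ennreal a"
        using a by (simp add: emeasure_restrict_space)
      finally show ?thesis
        using x a by (simp add: hardy_average_def divide_ennreal)
    qed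
    have "luxemburg_norm p {a<..<1} (\<lambda>x. ennreal (inverse x))
        \<le> ennreal (1 / a) * luxemburg_norm p {0<..<1} (hardy_average f)"
    proof (rule luxemburg_norm_le_mult)
      fix l :: real
      assume l: "0 < l"
        and le: "(\<integral>\<^sup>+ x. ennpowr (hardy_average f x / ennreal l) (p x) \<partial>(lebesgue_on {0<..<1})) \<le> 1"
      have "(\<integral>\<^sup>+ x. ennpowr (ennreal (inverse x) / ennreal (1 / a * l)) (p x) \<partial>(lebesgue_on {a<..<1}))
          \<le> (\<integral>\<^sup>+ x. ennpowr (hardy_average f x / ennreal l) (p x) \<partial>(lebesgue_on {0<..<1}))"
      proof (rule nn_integral_lebesgue_on_mono_set)
        fix x assume x: "x \<in> {a<..<1}"
        have "ennreal (inverse x) / ennreal (1 / a * l) = hardy_average f x / ennreal l"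
          unfolding average[OF x] using x a l by (simp add: divide_ennreal field_simps)
        then show "ennpowr (ennreal (inverse x) / ennreal (1 / a * l)) (p x)
            \<le> ennpowr (hardy_average f x / ennreal l) (p x)" by simp
      qed (use a in auto)
      with le show "(\<integral>\<^sup>+ x. ennpowr (ennreal (inverse x) / ennreal (1 / a * l)) (p x)
          \<partial>(lebesgue_on {a<..<1})) \<le> 1" by (rule order.trans[rotated])
    qed (use a in auto)
    also have "\<dots> \<le> ennreal (1 / a) * (ennreal C * luxemburg_norm p {0<..<1} (\<lambda>x. ennreal (f x)))"
      by (intro mult_left_mono hardy) (auto simp: f_def intro!: borel_measurable_imp_lebesgue_on)
    also have "\<dots> \<le> ennreal (1 / a) * (ennreal C * ennreal (a * \<phi> a))"
      using f_norm by (intro mult_left_mono) auto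
    also have "\<dots> = ennreal (C * \<phi> a)"
      using a C \<phi>_pos[OF a] by (simp add: ennreal_mult[symmetric])
    finally show ?thesis .
  qed
  with C show ?thesis
    unfolding tail_norm_condition_def \<phi>_def[symmetric] by (intro exI[of _ C]) auto
qed

section \<open>Sufficiency: power decay implies the Hardy inequality\<close>

text \<open>A weighted Young-type inequality in which the powers of the free parameter
  \<open>u\<close> depend on \<open>x\<close> only, so they can be taken out of an integral over
  \<open>t\<close>.\<close>

lemma hardy_pointwise:
  assumes "0 < \<epsilon>" "0 < C" "t \<in> {0<..<1}" "x \<in> {0<..<1}" "t \<le> x" "0 < u" "u \<le> 1" "0 \<le> y"
    and dec: "\<phi> x \<le> C * (t / x) powr \<epsilon> * \<phi> t"
  shows "y \<le> C / \<phi> x * u * ((t / x) powr \<epsilon> / t)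
      + C / \<phi> x * u powr (1 - p x) * ((t / x) powr \<epsilon> * y powr p t)"
proof -
  note pos = \<phi>_pos[OF assms(3)] \<phi>_pos[OF assms(4)]
  \<comment> \<open>Normalised so that \<open>g powr p t\<close> is \<open>t * y powr p t\<close>;
    the extra \<open>t\<close> cancels the later division by \<open>t\<close>.\<close>
  define g where "g = y * (t * \<phi> t)"
  have g: "0 \<le> g" using assms pos by (simp add: g_def)
  have g_powr: "g powr p t = y powr p t * t"
    unfolding g_def powr_mult[of y "t * \<phi> t"] mult_\<phi>_powr[OF assms(3)] ..
  have young: "g \<le> u + u powr (1 - p x) * g powr p t"
  proof (cases "g \<le> u")
    case True
    then show ?thesis by (simp add: add_increasing2)
  next
    case False
    then have "(g / u) powr 1 \<le> (g / u) powr p t"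
      using assms ge_1[OF assms(3)] by (intro powr_mono) auto
    then have "g \<le> u * (g / u) powr p t"
      using assms g by (simp add: field_simps)
    also have "\<dots> = u powr (1 - p t) * g powr p t"
      using assms g by (simp add: powr_divide powr_diff)
    \<comment> \<open>This uses \<open>u \<le> 1\<close> together with
      \<open>p t \<le> p x\<close>.\<close>
    also have "\<dots> \<le> u powr (1 - p x) * g powr p t"
      using assms mono_onD[OF mono assms(3-5)] by (intro mult_right_mono powr_mono') auto
    finally show ?thesis using assms by simp
  qed
  have inv: "1 / \<phi> t \<le> C / \<phi> x * (t / x) powr \<epsilon>"
    using dec pos by (simp add: field_simps)
  have "y = g / t * (1 / \<phi> t)"
    using assms pos by (simp add: g_def)
  also have "\<dots> \<le> (u + u powr (1 - p x) * g powr p t) / t * (C / \<phi> x * (t / x) powr \<epsilon>)"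
    using young g assms pos inv by (intro mult_mono divide_right_mono) auto
  also have "\<dots> = C / \<phi> x * u * ((t / x) powr \<epsilon> / t)
      + C / \<phi> x * u powr (1 - p x) * ((t / x) powr \<epsilon> * y powr p t)"
    unfolding g_powr using assms by (simp add: add_divide_distrib algebra_simps)
  finally show ?thesis .
qed

text \<open>The bound of \<open>hardy_pointwise\<close> is integrated over \<open>(0, x)\<close>
  with the same \<open>u\<close> for all \<open>t\<close>. Up to the factor
  \<open>C / \<phi> x\<close>, its terms contribute \<open>u / \<epsilon>\<close> and
  \<open>u powr (1 - p x) * m\<close>.\<close>

lemma hardy_average_bound:
  fixes f :: "real \<Rightarrow> real"
  assumes \<epsilon>: "0 < \<epsilon>" and C: "0 < C"
    and dec: "\<And>s t. 0 < s \<Longrightarrow> s \<le> t \<Longrightarrow> t < 1 \<Longrightarrow> \<phi> t \<le> C * (s / t) powr \<epsilon> * \<phi> s"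
    and f: "f \<in> borel_measurable (lebesgue_on {0<..<1})" "\<And>t. t \<in> {0<..<1} \<Longrightarrow> 0 \<le> f t"
    and x: "x \<in> {0<..<1}"
    and modular: "(\<integral>\<^sup>+ t. ennreal (f t powr p t) \<partial>(lebesgue_on {0<..<1})) \<le> 1"
  shows "ennpowr (hardy_average f x / ennreal (C * (1 / \<epsilon> + 1))) (p x)
    \<le> (\<integral>\<^sup>+ t. ennreal ((t / x) powr \<epsilon> * f t powr p t) \<partial>(lebesgue_on {0<..<x})) / ennreal x"
proof -
  let ?N = "lebesgue_on {0<..<x}"
  have sub: "{0<..<x} \<subseteq> {0<..<1}" using x by auto
  note p_measurable[OF sub, measurable]
  have [measurable]: "f \<in> borel_measurable ?N"
    using sub by (rule measurable_restrict_mono[OF f(1)])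
  have [measurable]: "(\<lambda>t. t) \<in> borel_measurable ?N"
    by (simp add: borel_measurable_imp_lebesgue_on)
  note px = ge_1[OF x]
  define h where "h = (\<lambda>t. (t / x) powr \<epsilon> * f t powr p t)"
  have [measurable]: "h \<in> borel_measurable ?N" unfolding h_def by measurable
  define M where "M = (\<integral>\<^sup>+ t. ennreal (h t) \<partial>?N)"
  have "M \<le> (\<integral>\<^sup>+ t. ennreal (f t powr p t) \<partial>(lebesgue_on {0<..<1}))"
    unfolding M_def
  proof (rule nn_integral_lebesgue_on_mono_set)
    fix t assume "t \<in> {0<..<x}"
    then have "(t / x) powr \<epsilon> \<le> 1" using \<epsilon> by (intro powr_le1) auto
    then show "ennreal (h t) \<le> ennreal (f t powr p t)"
      unfolding h_def by (intro ennreal_leI) (simp add: mult_left_le_one_le)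
  qed (use sub in auto)
  \<comment> \<open>This is what makes \<open>u \<le> 1\<close> below.\<close>
  with modular have M_le: "M \<le> 1" by simp
  then obtain m where m: "M = ennreal m" "0 \<le> m" "m \<le> 1"
    by (cases M) (auto simp: top_unique)
  \<comment> \<open>The value that balances both terms, as then
    \<open>u powr (1 - p x) * m = u\<close>.\<close>
  define u where "u = m powr (1 / p x)"
  have average: "(\<integral>\<^sup>+ t. ennreal (f t) \<partial>?N) \<le> ennreal (C / \<phi> x * (1 / \<epsilon> + 1) * u)"
  proof (cases "m = 0")
    \<comment> \<open>Here \<open>u\<close> would be 0, which the pointwise bound excludes; instead
      \<open>f\<close> vanishes almost everywhere on \<open>(0, x)\<close>.\<close>
    case True
    then have "AE t in ?N. ennreal (h t) = 0"
      using m nn_integral_0_iff_AE[of "\<lambda>t. ennreal (h t)" ?N] by (simp add: M_def)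
    moreover have "AE t in ?N. t \<in> {0<..<x}"
      using AE_space[of ?N] by simp
    ultimately have "AE t in ?N. ennreal (f t) = 0"
    proof eventually_elim
      case (elim t)
      have "0 < (t / x) powr \<epsilon>" using elim x by simp
      moreover have "0 \<le> h t" by (simp add: h_def)
      with elim have "h t = 0" by (simp add: ennreal_eq_0_iff)
      ultimately show ?case by (simp add: h_def)
    qed
    then have "(\<integral>\<^sup>+ t. ennreal (f t) \<partial>?N) = 0"
      by (subst nn_integral_0_iff_AE) auto
    then show ?thesis by simp
  next
    case False
    with m have m0: "0 < m" by simp
    have u: "0 < u" "u \<le> 1"
      using m m0 px by (auto simp: u_def intro!: powr_le1)
    have u_powr: "u powr (1 - p x) * m = u"
    proof -
      have "m = u powr p x" using m0 px by (simp add: u_def powr_powr)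
      with u show ?thesis by (simp add: powr_add[symmetric])
    qed
    define A B where "A = C / \<phi> x * u" and "B = C / \<phi> x * u powr (1 - p x)"
    have AB: "0 \<le> A" "0 \<le> B" using C u \<phi>_pos[OF x] by (simp_all add: A_def B_def)
    have "(\<integral>\<^sup>+ t. ennreal (f t) \<partial>?N)
        \<le> (\<integral>\<^sup>+ t. ennreal A * ennreal ((t / x) powr \<epsilon> / t) + ennreal B * ennreal (h t) \<partial>?N)"
    proof (rule nn_integral_lebesgue_on_mono_set)
      fix t assume t: "t \<in> {0<..<x}"
      have "f t \<le> A * ((t / x) powr \<epsilon> / t) + B * h t"
        unfolding A_def B_def h_def
        using t x u C \<epsilon> f(2)[of t] dec[of t x] by (intro hardy_pointwise) auto
      moreover have "0 \<le> (t / x) powr \<epsilon> / t" "0 \<le> h t" using t by (simp_all add: h_def)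
      ultimately show "ennreal (f t) \<le> ennreal A * ennreal ((t / x) powr \<epsilon> / t) + ennreal B * ennreal (h t)"
        using AB by (simp only: ennreal_mult[symmetric] ennreal_plus[symmetric] mult_nonneg_nonneg ennreal_leI)
    qed auto
    also have "\<dots> = ennreal A * (\<integral>\<^sup>+ t. ennreal ((t / x) powr \<epsilon> / t) \<partial>?N) + ennreal B * M"
      unfolding M_def by (simp add: nn_integral_add nn_integral_cmult)
    also have "\<dots> = ennreal (A / \<epsilon> + B * m)"
      using \<epsilon> x AB m
      by (simp add: nn_integral_powr_left ennreal_mult[symmetric] ennreal_plus[symmetric] del: ennreal_plus)
    also have "A / \<epsilon> + B * m = C / \<phi> x * (u / \<epsilon> + u powr (1 - p x) * m)"
      by (simp add: A_def B_def algebra_simps)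
    also have "\<dots> = C / \<phi> x * (1 / \<epsilon> + 1) * u"
      unfolding u_powr by (simp add: algebra_simps)
    finally show ?thesis .
  qed
  have D: "0 < C * (1 / \<epsilon> + 1)" using C \<epsilon> by (simp add: add_pos_pos)
  have "hardy_average f x / ennreal (C * (1 / \<epsilon> + 1))
      \<le> ennreal (C / \<phi> x * (1 / \<epsilon> + 1) * u) / ennreal x / ennreal (C * (1 / \<epsilon> + 1))"
    unfolding hardy_average_def by (intro divide_right_mono_ennreal average)
  also have "\<dots> = ennreal (C / \<phi> x * (1 / \<epsilon> + 1) * u / x / (C * (1 / \<epsilon> + 1)))"
    using x C \<epsilon> D \<phi>_pos[OF x] by (simp add: divide_ennreal u_def)
  also have "C / \<phi> x * (1 / \<epsilon> + 1) * u / x / (C * (1 / \<epsilon> + 1)) = u / (x * \<phi> x)"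
  proof -
    have "1 / \<epsilon> + 1 \<noteq> 0" "C \<noteq> 0" using D by auto
    then show ?thesis by (simp add: mult.commute)
  qed
  finally have "ennpowr (hardy_average f x / ennreal (C * (1 / \<epsilon> + 1))) (p x)
      \<le> ennpowr (ennreal (u / (x * \<phi> x))) (p x)"
    using px by (intro ennpowr_mono) auto
  also have "\<dots> = ennreal ((u / (x * \<phi> x)) powr p x)"
    using x \<phi>_pos[OF x] by (intro ennpowr_ennreal) (auto simp: u_def)
  \<comment> \<open>The numerator becomes \<open>m\<close> by the choice of \<open>u\<close>, the
    denominator \<open>x\<close> by \<open>mult_\<phi>_powr\<close>.\<close>
  also have "(u / (x * \<phi> x)) powr p x = m / x"
    unfolding powr_divide mult_\<phi>_powr[OF x] using m px by (simp add: u_def powr_powr)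
  also have "ennreal (m / x) = M / ennreal x"
    using m x by (simp add: divide_ennreal)
  finally show ?thesis by (simp add: M_def h_def)
qed

text \<open>Exchanging the integrals leaves, for fixed \<open>t\<close>, the integral of
  \<open>(t / x) powr \<epsilon> / x\<close> over \<open>(t, 1)\<close>, which is at most
  \<open>1 / \<epsilon>\<close>.\<close>

lemma hardy_tonelli:
  fixes f :: "real \<Rightarrow> real"
  assumes \<epsilon>: "0 < \<epsilon>" and f: "f \<in> borel_measurable (lebesgue_on {0<..<1})"
  shows "(\<integral>\<^sup>+ x. (\<integral>\<^sup>+ t. ennreal ((t / x) powr \<epsilon> * f t powr p t) \<partial>(lebesgue_on {0<..<x})) / ennreal x
            \<partial>(lebesgue_on {0<..<1}))
    \<le> ennreal (1 / \<epsilon>) * (\<integral>\<^sup>+ t. ennreal (f t powr p t) \<partial>(lebesgue_on {0<..<1}))"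
proof -
  let ?N = "lebesgue_on {0<..<1::real}"
  interpret N: finite_measure ?N
    by (rule finite_measure_lebesgue_on) simp
  interpret N2: pair_sigma_finite ?N ?N ..
  note f[measurable] p_measurable[OF order.refl, measurable]
  have [measurable]: "(\<lambda>t. t) \<in> borel_measurable ?N"
    by (simp add: borel_measurable_imp_lebesgue_on)
  \<comment> \<open>Extending the kernel by 0 off the triangle \<open>t < x\<close> replaces the
    moving domain \<open>(0, x)\<close> by the fixed \<open>(0, 1)\<close>, where the integrals can
    be exchanged.\<close>
  define k where "k = (\<lambda>x t. if t < x then ennreal ((t / x) powr \<epsilon> / x) else 0)"
  have [measurable]: "(\<lambda>(x, t). k x t) \<in> borel_measurable (?N \<Otimes>\<^sub>M ?N)"
    unfolding k_def by measurable
  have "(\<integral>\<^sup>+ t. ennreal ((t / x) powr \<epsilon> * f t powr p t) \<partial>(lebesgue_on {0<..<x})) / ennreal x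
      = (\<integral>\<^sup>+ t. k x t * ennreal (f t powr p t) \<partial>?N)" if x: "x \<in> {0<..<1}" for x
  proof -
    have sub: "{0<..<x} \<subseteq> {0<..<1}" using x by auto
    note p_measurable[OF sub, measurable]
    have [measurable]: "f \<in> borel_measurable (lebesgue_on {0<..<x})"
      using sub by (rule measurable_restrict_mono[OF f(1)])
    have [measurable]: "(\<lambda>t. t) \<in> borel_measurable (lebesgue_on {0<..<x})"
      by (simp add: borel_measurable_imp_lebesgue_on)
    have "(\<integral>\<^sup>+ t. ennreal ((t / x) powr \<epsilon> * f t powr p t) \<partial>(lebesgue_on {0<..<x})) / ennreal x
        = (\<integral>\<^sup>+ t. ennreal ((t / x) powr \<epsilon> * f t powr p t) / ennreal x \<partial>(lebesgue_on {0<..<x}))"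
      by (rule nn_integral_divide[symmetric]) measurable
    also have "\<dots> = (\<integral>\<^sup>+ t. ennreal ((t / x) powr \<epsilon> * f t powr p t) / ennreal x * indicator {0<..<x} t \<partial>?N)"
      using sub by (intro nn_integral_lebesgue_on_subset) auto
    also have "\<dots> = (\<integral>\<^sup>+ t. k x t * ennreal (f t powr p t) \<partial>?N)"
    proof (rule nn_integral_cong)
      fix t assume "t \<in> space ?N"
      then show "ennreal ((t / x) powr \<epsilon> * f t powr p t) / ennreal x * indicator {0<..<x} t
          = k x t * ennreal (f t powr p t)"
        using x by (auto simp: k_def divide_ennreal ennreal_mult[symmetric] split: split_indicator)
    qed
    finally show ?thesis .
  qed
  then have "(\<integral>\<^sup>+ x. (\<integral>\<^sup>+ t. ennreal ((t / x) powr \<epsilon> * f t powr p t) \<partial>(lebesgue_on {0<..<x})) / ennreal x \<partial>?N)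
      = (\<integral>\<^sup>+ x. (\<integral>\<^sup>+ t. k x t * ennreal (f t powr p t) \<partial>?N) \<partial>?N)"
    by (intro nn_integral_cong) auto
  also have "\<dots> = (\<integral>\<^sup>+ t. (\<integral>\<^sup>+ x. k x t * ennreal (f t powr p t) \<partial>?N) \<partial>?N)"
    by (rule N2.Fubini'[symmetric]) measurable
  also have "\<dots> \<le> (\<integral>\<^sup>+ t. ennreal (1 / \<epsilon>) * ennreal (f t powr p t) \<partial>?N)"
  proof (rule nn_integral_mono)
    fix t assume "t \<in> space ?N"
    then have t: "t \<in> {0<..<1}" by simp
    have [measurable]: "(\<lambda>x. k x t) \<in> borel_measurable ?N"
      unfolding k_def by measurable
    have "(\<integral>\<^sup>+ x. k x t * ennreal (f t powr p t) \<partial>?N) = (\<integral>\<^sup>+ x. k x t \<partial>?N) * ennreal (f t powr p t)"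
      by (rule nn_integral_multc) measurable
    also have "(\<integral>\<^sup>+ x. k x t \<partial>?N)
        = (\<integral>\<^sup>+ x. ennreal ((t / x) powr \<epsilon> / x) * indicator {t<..<1} x \<partial>?N)"
      by (intro nn_integral_cong) (auto simp: k_def split: split_indicator)
    also have "\<dots> = (\<integral>\<^sup>+ x. ennreal ((t / x) powr \<epsilon> / x) \<partial>(lebesgue_on {t<..<1}))"
      using t by (intro nn_integral_lebesgue_on_subset[symmetric]) auto
    also have "\<dots> * ennreal (f t powr p t) \<le> ennreal (1 / \<epsilon>) * ennreal (f t powr p t)"
      using t \<epsilon> by (intro mult_right_mono nn_integral_powr_right_le) auto
    finally show "(\<integral>\<^sup>+ x. k x t * ennreal (f t powr p t) \<partial>?N) \<le> ennreal (1 / \<epsilon>) * ennreal (f t powr p t)" .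
  qed
  also have "\<dots> = ennreal (1 / \<epsilon>) * (\<integral>\<^sup>+ t. ennreal (f t powr p t) \<partial>?N)"
    by (rule nn_integral_cmult) measurable
  finally show ?thesis .
qed

lemma almost_decreasing_imp_hardy:
  assumes "almost_decreasing_condition p"
  shows "hardy_inequality p"
proof -
  obtain \<epsilon> C where \<epsilon>: "0 < \<epsilon>" and C: "0 < C"
    and dec: "\<And>s t. 0 < s \<Longrightarrow> s \<le> t \<Longrightarrow> t < 1 \<Longrightarrow> \<phi> t \<le> C * (s / t) powr \<epsilon> * \<phi> s"
    using assms unfolding almost_decreasing_iff by blast
  let ?N = "lebesgue_on {0<..<1::real}"
  define D where "D = C * (1 / \<epsilon> + 1)"
  \<comment> \<open>Dividing \<open>f\<close> by \<open>E * l\<close> instead of \<open>l\<close>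
    brings the modular below \<open>1 / E\<close>, which absorbs the factor
    \<open>1 / \<epsilon>\<close> from the exchange of integrals; \<open>E \<ge> 1\<close> gives
    \<open>E powr p x \<ge> E\<close> and keeps the modular at most 1.\<close>
  define E where "E = max 1 (1 / \<epsilon>)"
  have D: "0 < D" using C \<epsilon> by (simp add: D_def add_pos_pos)
  have E: "1 \<le> E" "1 / \<epsilon> \<le> E" by (simp_all add: E_def)
  have "luxemburg_norm p {0<..<1} (hardy_average f)
      \<le> ennreal (D * E) * luxemburg_norm p {0<..<1} (\<lambda>x. ennreal (f x))"
    if f: "f \<in> borel_measurable ?N" and nonneg: "\<And>x. x \<in> {0<..<1} \<Longrightarrow> 0 \<le> f x" for f
  proof (rule luxemburg_norm_le_mult)
    show "0 < D * E" using D E by simp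
    fix l :: real
    assume l: "0 < l" and le: "(\<integral>\<^sup>+ x. ennpowr (ennreal (f x) / ennreal l) (p x) \<partial>?N) \<le> 1"
    define g where "g = (\<lambda>x. f x / (E * l))"
    have g: "g \<in> borel_measurable ?N" "\<And>x. x \<in> {0<..<1} \<Longrightarrow> 0 \<le> g x"
      using f nonneg l E by (auto simp: g_def)
    note f[measurable] p_measurable[OF order.refl, measurable]
    have "(\<integral>\<^sup>+ x. ennreal (g x powr p x) \<partial>?N) \<le> (\<integral>\<^sup>+ x. ennreal (1 / E) * ennreal ((f x / l) powr p x) \<partial>?N)"
    proof (rule nn_integral_lebesgue_on_mono_set)
      fix x :: real assume x: "x \<in> {0<..<1}"
      have "E powr 1 \<le> E powr p x"
        using E ge_1[OF x] by (intro powr_mono) auto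
      then have "(f x / l) powr p x / E powr p x \<le> (f x / l) powr p x / E"
        using E by (intro divide_left_mono) auto
      moreover have "g x powr p x = (f x / l) powr p x / E powr p x"
        unfolding powr_divide[symmetric] by (simp add: g_def mult.commute)
      ultimately show "ennreal (g x powr p x) \<le> ennreal (1 / E) * ennreal ((f x / l) powr p x)"
        using E by (subst ennreal_mult[symmetric]) (auto intro!: ennreal_leI)
    qed auto
    also have "\<dots> = ennreal (1 / E) * (\<integral>\<^sup>+ x. ennreal ((f x / l) powr p x) \<partial>?N)"
      by (rule nn_integral_cmult) measurable
    also have "(\<integral>\<^sup>+ x. ennreal ((f x / l) powr p x) \<partial>?N) = (\<integral>\<^sup>+ x. ennpowr (ennreal (f x) / ennreal l) (p x) \<partial>?N)"
      using nonneg l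
      by (intro nn_integral_cong) (auto simp: divide_ennreal ennpowr_ennreal)
    also have "ennreal (1 / E) * \<dots> \<le> ennreal (1 / E) * 1"
      using le by (intro mult_left_mono) auto
    finally have modular: "(\<integral>\<^sup>+ x. ennreal (g x powr p x) \<partial>?N) \<le> ennreal (1 / E)" by simp
    also have "\<dots> \<le> 1" using E by simp
    finally have modular_1: "(\<integral>\<^sup>+ x. ennreal (g x powr p x) \<partial>?N) \<le> 1" .
    have average: "hardy_average f x = ennreal (E * l) * hardy_average g x" if x: "x \<in> {0<..<1}" for x
    proof -
      have sub: "{0<..<x} \<subseteq> {0<..<1}" using x by auto
      have [measurable]: "g \<in> borel_measurable (lebesgue_on {0<..<x})"
        using sub by (rule measurable_restrict_mono[OF g(1)])
      have "(\<integral>\<^sup>+ t. ennreal (f t) \<partial>(lebesgue_on {0<..<x}))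
          = (\<integral>\<^sup>+ t. ennreal (E * l) * ennreal (g t) \<partial>(lebesgue_on {0<..<x}))"
        using l E x g(2) by (intro nn_integral_cong) (auto simp: ennreal_mult[symmetric] g_def)
      also have "\<dots> = ennreal (E * l) * (\<integral>\<^sup>+ t. ennreal (g t) \<partial>(lebesgue_on {0<..<x}))"
        by (rule nn_integral_cmult) measurable
      finally show ?thesis by (simp add: hardy_average_def ennreal_times_divide)
    qed
    have "(\<integral>\<^sup>+ x. ennpowr (hardy_average f x / ennreal (D * E * l)) (p x) \<partial>?N)
        \<le> (\<integral>\<^sup>+ x. (\<integral>\<^sup>+ t. ennreal ((t / x) powr \<epsilon> * g t powr p t) \<partial>(lebesgue_on {0<..<x})) / ennreal x \<partial>?N)"
    proof (rule nn_integral_lebesgue_on_mono_set)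
      fix x :: real assume x: "x \<in> {0<..<1}"
      have "ennreal (D * E * l) = ennreal (E * l) * ennreal D"
        using D E l by (simp add: ennreal_mult[symmetric] mult_ac)
      \<comment> \<open>Cancellation in the extended half-line: the average is treated separately
        when it is infinite.\<close>
      then have "hardy_average f x / ennreal (D * E * l) = hardy_average g x / ennreal D"
        unfolding average[OF x] using E l D
        by (cases "hardy_average g x")
          (auto simp: divide_ennreal ennreal_mult[symmetric] ennreal_mult_top ennreal_top_divide)
      then show "ennpowr (hardy_average f x / ennreal (D * E * l)) (p x)
          \<le> (\<integral>\<^sup>+ t. ennreal ((t / x) powr \<epsilon> * g t powr p t) \<partial>(lebesgue_on {0<..<x})) / ennreal x"
        unfolding D_def using hardy_average_bound[OF \<epsilon> C dec g x modular_1] by simp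
    qed auto
    also have "\<dots> \<le> ennreal (1 / \<epsilon>) * (\<integral>\<^sup>+ t. ennreal (g t powr p t) \<partial>?N)"
      by (rule hardy_tonelli[OF \<epsilon> g(1)])
    also have "\<dots> \<le> ennreal (1 / \<epsilon>) * ennreal (1 / E)"
      using modular by (intro mult_left_mono) auto
    also have "\<dots> = ennreal ((1 / \<epsilon>) / E)"
      using E \<epsilon> by (simp add: ennreal_mult[symmetric])
    also have "\<dots> \<le> 1"
      using E \<epsilon> by (simp add: field_simps)
    finally show "(\<integral>\<^sup>+ x. ennpowr (hardy_average f x / ennreal (D * E * l)) (p x) \<partial>?N) \<le> 1" .
  qed
  with D E show ?thesis
    unfolding hardy_inequality_def by (intro exI[of _ "D * E"]) auto
qed

end

theorem theorem2p2:
  fixes p :: "real \<Rightarrow> real"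
  assumes "\<And>x. x \<in> {0<..<1} \<Longrightarrow> 1 \<le> p x"
    and "mono_on {0<..<1} p"
    and "bdd_above (p ` {0<..<1})"
  shows "(hardy_inequality p \<longleftrightarrow> tail_integral_condition p) \<and>
         (tail_integral_condition p \<longleftrightarrow> almost_decreasing_condition p) \<and>
         (almost_decreasing_condition p \<longleftrightarrow> tail_modular_condition p) \<and>
         (tail_modular_condition p \<longleftrightarrow> tail_norm_condition p)"
proof -
  from assms(3) obtain P where "\<And>x. x \<in> {0<..<1} \<Longrightarrow> p x \<le> P"
    unfolding bdd_above_def by (metis imageI)
  with assms interpret increasing_exponent p P
    by unfold_locales auto
  \<comment> \<open>The Hardy inequality, the tail norm, the tail modular and the almost decreasing
    condition form a closed cycle of implications in this order; the tail integral condition is tied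
    to the last of them in both directions.\<close>
  show ?thesis
    using hardy_imp_tail_norm tail_norm_imp_tail_modular tail_modular_imp_tail_norm
      tail_modular_imp_almost_decreasing almost_decreasing_imp_hardy
      almost_decreasing_imp_tail_integral tail_integral_imp_almost_decreasing
      almost_decreasing_imp_tail_modular
    by blast
qed

end
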